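(* Let $\varepsilon > 0$. Then there exists a Carleson measure $\mu$ on $\mathbb{R}^2_+$ with $\mathrm{Carl}(\mu) = 1$ and $$\|S_\mu\|_{\mathrm{BMO}} + \|S_\mu\|_{1} < \varepsilon,$$ where $S_\mu$ is the (Poisson) balayage of $\mu$ and $\|\cdot\|_1$ is the norm of $L^1(\mathbb{R})$.
   Context: $\mathbb{R}^2_+ = \{(x,y)\in\mathbb{R}^2 : y>0\}$ is the upper half-plane. Measures on $\mathbb{R}^2_+$ are positive regular Borel measures. For a bounded interval $I\subset\mathbb{R}$ of length $|I|>0$, the Carleson square is $Q_I=\{(x,y): x\in I,\ 0<y\le |I|\}$. $\mathcal{D}$ denotes the set of left-half-open dyadic intervals $(k2^n,(k+1)2^n]$, $k,n\in\mathbb{Z}$. A measure $\mu$ is a Carleson measure if there is a constant $C>0$ with $\mu(Q_I)\le C|I|$ for every interval $I\subset\mathbb{R}$ (equivalently, for every $I\in\mathcal{D}$). $\mathrm{Carl}(\mu)$ is the infimum of all $C>0$ such that $\mu(Q_I)\le C|I|$ for all $I\in\mathcal{D}$. The balayage of $\mu$ is the function $S_\mu(t)=\int_{\mathbb{R}^2_+}p_{x,y}(t)\,d\mu(x,y)$, $t\in\mathbb{R}$, where $p_{x,y}(t)=\frac1\pi\frac{y}{y^2+(t-x)^2}$ is the Poisson kernel of $\mathbb{R}^2_+$. $\|b\|_{\mathrm{BMO}}=\sup_{I\subset\mathbb{R}\text{ interval}}\frac1{|I|}\int_I|b(t)-\langle b\rangle_I|\,dt$, the supremum being over all bounded intervals,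 where $\langle b\rangle_I=\frac1{|I|}\int_I b(t)\,dt$. $\mathrm{BMO}(\mathbb{R})$ is the class of $b\in L^2(\mathbb{R})$ for which this is finite. *)

theory Defs
  imports "HOL-Analysis.Analysis"
begin

section \<open>Carleson measures on the upper half-plane\<close>

definition upper_half_plane :: "(real \<times> real) set" where
  "upper_half_plane = {(x, y). 0 < y}"

text \<open>
  The half-plane is open in the plane, so its relatively open subsets are just the open
  subsets of the plane contained in it.
\<close>

definition regular_borel_measure :: "(real \<times> real) measure \<Rightarrow> bool" where
  "regular_borel_measure \<mu> \<longleftrightarrow>
     sets \<mu> = sets (restrict_space borel upper_half_plane) \<and>
     (\<forall>K. compact K \<and> K \<subseteq> upper_half_plane \<longrightarrow> emeasure \<mu> K < \<infinity>) \<and>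
     (\<forall>A\<in>sets \<mu>. emeasure \<mu> A =
        (INF U\<in>{U. open U \<and> A \<subseteq> U \<and> U \<subseteq> upper_half_plane}. emeasure \<mu> U)) \<and>
     (\<forall>A\<in>sets \<mu>. emeasure \<mu> A = (SUP K\<in>{K. compact K \<and> K \<subseteq> A}. emeasure \<mu> K))"

definition len :: "real set \<Rightarrow> real" where
  "len I = measure lborel I"

definition bounded_intervals :: "real set set" where
  "bounded_intervals = {I. is_interval I \<and> bounded I \<and> 0 < len I}"

definition dyadic_intervals :: "real set set" where
  "dyadic_intervals =
     {{of_int k * 2 powi n <.. (of_int k + 1) * 2 powi n} | k n :: int. True}"

definition carleson_square :: "real set \<Rightarrow> (real \<times> real) set" where
  "carleson_square I = {(x, y). x \<in> I \<and> 0 < y \<and> y \<le> len I}"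

definition carleson_measure :: "(real \<times> real) measure \<Rightarrow> bool" where
  "carleson_measure \<mu> \<longleftrightarrow>
     regular_borel_measure \<mu> \<and>
     (\<exists>C>0. \<forall>I\<in>bounded_intervals. emeasure \<mu> (carleson_square I) \<le> ennreal (C * len I))"

definition Carl :: "(real \<times> real) measure \<Rightarrow> ennreal" where
  "Carl \<mu> = (INF C\<in>{C::real. 0 < C \<and>
     (\<forall>I\<in>dyadic_intervals. emeasure \<mu> (carleson_square I) \<le> ennreal (C * len I))}. ennreal C)"

section \<open>The Poisson balayage\<close>

definition poisson_kernel :: "real \<Rightarrow> real \<Rightarrow> real \<Rightarrow> real" where
  "poisson_kernel x y t = (1 / pi) * (y / (y\<^sup>2 + (t - x)\<^sup>2))"

text \<open>
  The kernel is positive on the half-plane, so the balayage is defined for every measure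
  as a function with values in \<open>[0, \<infinity>]\<close>; for a general Carleson measure it may be infinite.
\<close>

definition balayage :: "(real \<times> real) measure \<Rightarrow> real \<Rightarrow> ennreal" where
  "balayage \<mu> t = (\<integral>\<^sup>+ (x, y). ennreal (poisson_kernel x y t) \<partial>\<mu>)"

text \<open>
  The real-valued version differs from \<open>balayage \<mu>\<close> only where the latter is infinite,
  which is a null set whenever \<open>balayage \<mu>\<close> has finite integral.
\<close>

definition real_balayage :: "(real \<times> real) measure \<Rightarrow> real \<Rightarrow> real" where
  "real_balayage \<mu> t = enn2real (balayage \<mu> t)"

definition balayage_L1_norm :: "(real \<times> real) measure \<Rightarrow> ennreal" where
  "balayage_L1_norm \<mu> = (\<integral>\<^sup>+ t. balayage \<mu> t \<partial>lborel)"

section \<open>Bounded mean oscillation\<close>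

definition avg :: "(real \<Rightarrow> real) \<Rightarrow> real set \<Rightarrow> real" where
  "avg b I = (1 / len I) * (LINT t:I|lborel. b t)"

text \<open>
  If the measurable function \<open>b\<close> is not integrable on \<open>I\<close>, then \<open>avg b I = 0\<close> by
  convention and the term for \<open>I\<close> in the supremum is infinite.
\<close>

definition BMO_norm :: "(real \<Rightarrow> real) \<Rightarrow> ennreal" where
  "BMO_norm b =
     (SUP I\<in>bounded_intervals. ennreal (1 / len I) * (\<integral>\<^sup>+ t\<in>I. ennreal \<bar>b t - avg b I\<bar> \<partial>lborel))"

definition BMO :: "(real \<Rightarrow> real) set" where
  "BMO = {b \<in> borel_measurable lborel. integrable lborel (\<lambda>t. (b t)\<^sup>2) \<and> BMO_norm b < \<infinity>}"

end

theory Submission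
  imports Defs "HOL-Probability.Probability_Measure"
begin

text \<open>
  Take \<open>\<mu> = \<phi>(x) dx\<close> on the horizontal line \<open>y = h\<close>, with \<open>0 \<le> \<phi> \<le> 1\<close> and \<open>\<phi> = 1\<close> on the dyadic
  interval \<open>{0<..h}\<close>: then the Carleson constant is exactly 1, whereas the balayage is a Poisson
  average of translates of \<open>\<phi>\<close>, so its mean oscillation is no worse than that of \<open>\<phi>\<close>. For \<open>\<phi>\<close> we use
  the average of the indicators of \<open>{-r/2^k..r/2^k}\<close>, \<open>k < N\<close>, a discrete version of a truncated
  multiple of \<open>log (r/\<bar>x\<bar>)\<close>. Its oscillation is \<open>O(1/N)\<close> and its integral is at most \<open>2r\<close>.

  As \<open>\<phi>\<close> is even and decreasing in \<open>\<bar>x\<bar>\<close>, on an interval with endpoints \<open>a, b\<close> it is bounded below by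
  \<open>\<phi> (max \<bar>a\<bar> \<bar>b\<bar>)\<close>. Comparing with this lower bound instead of the mean makes every
  difference nonnegative and makes the comparison constant a measurable function of the translation.
\<close>

section \<open>Endpoints of intervals and the total mass of the Poisson kernel\<close>

text \<open>\<open>I\<close> lies between \<open>{a<..<b}\<close> and \<open>{a..b}\<close> for its
  infimum \<open>a\<close> and supremum \<open>b\<close>, and these two sets have equal measure.
  Later arguments can thus ignore which endpoints belong to \<open>I\<close>.\<close>

lemma bounded_intervals_enclosure:
  fixes I :: "real set"
  assumes "I \<in> bounded_intervals"
  obtains a b where "a < b" "I \<subseteq> {a..b}" "len I = b - a" "I \<in> sets borel"
proof -
  have I: "is_interval I" "bounded I" "0 < len I"
    using assms by (auto simp: bounded_intervals_def)
  define a b where "a = Inf I" and "b = Sup I"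
  have "I \<noteq> {}" and bdd: "bdd_below I" "bdd_above I"
    using I by (auto simp: len_def bounded_imp_bdd_below bounded_imp_bdd_above)
  have [measurable]: "I \<in> sets borel"
    using I(1) by (rule real_interval_borel_measurable)
  have sub: "I \<subseteq> {a..b}"
    using bdd by (auto simp: a_def b_def cInf_lower cSup_upper)
  then have "a \<le> b" using \<open>I \<noteq> {}\<close> by auto
  have sup: "{a<..<b} \<subseteq> I"
  proof
    fix x assume "x \<in> {a<..<b}"
    then obtain y z where "y \<in> I" "y < x" "z \<in> I" "x < z"
      using \<open>I \<noteq> {}\<close> cInf_lessD less_cSupD by (metis a_def b_def greaterThanLessThan_iff)
    then show "x \<in> I" using I(1) by (meson less_imp_le mem_is_interval_1_I)
  qed
  have "emeasure lborel I = ennreal (b - a)"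
    using emeasure_mono[OF sub, of lborel] emeasure_mono[OF sup, of lborel] \<open>a \<le> b\<close> by simp
  then have "len I = b - a" using \<open>a \<le> b\<close> by (simp add: len_def measure_def)
  with I(3) sub show ?thesis by (intro that[of a b]) auto
qed

text \<open>The antiderivative \<open>arctan\<close> handles the half-line from 0; the reflection
  \<open>x\<close> to \<open>-x\<close> handles the other one, up to the null set
  \<open>{0}\<close>.\<close>

lemma nn_integral_inverse_1_plus_square:
  "(\<integral>\<^sup>+ x. ennreal (1 / (1 + x\<^sup>2)) \<partial>lborel) = ennreal pi"
proof -
  let ?f = "\<lambda>x::real. ennreal (1 / (1 + x\<^sup>2))"
  have half: "(\<integral>\<^sup>+ x. ?f x * indicator {0..} x \<partial>lborel) = ennreal (pi/2)"
  proof (subst nn_integral_FTC_atLeast[where F = arctan and T = "pi/2"])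
    show "(arctan \<longlongrightarrow> pi / 2) at_top" by (rule tendsto_arctan_at_top)
  qed (auto intro!: derivative_eq_intros simp: inverse_eq_divide)
  have other: "(\<integral>\<^sup>+ x. ?f x * indicator {..<0} x \<partial>lborel) = ennreal (pi/2)"
  proof -
    have "(\<integral>\<^sup>+ x. ?f x * indicator {..<0} x \<partial>lborel) = (\<integral>\<^sup>+ x. ?f x * indicator {0<..} x \<partial>lborel)"
      by (subst nn_integral_real_affine[where c = "-1" and t = 0])
         (auto simp: indicator_def intro!: nn_integral_cong)
    also have "\<dots> = (\<integral>\<^sup>+ x. ?f x * indicator {0..} x \<partial>lborel)"
      using AE_lborel_singleton[of 0] by (intro nn_integral_cong_AE) (auto simp: indicator_def elim!: eventually_mono)
    finally show ?thesis using half by simp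
  qed
  have "(\<integral>\<^sup>+ x. ?f x \<partial>lborel) = (\<integral>\<^sup>+ x. ?f x * indicator {0..} x + ?f x * indicator {..<0} x \<partial>lborel)"
    by (auto intro!: nn_integral_cong simp: indicator_def)
  also have "\<dots> = ennreal (pi/2) + ennreal (pi/2)"
    by (subst nn_integral_add) (auto simp: half other)
  finally show ?thesis by (simp flip: ennreal_plus)
qed

lemma poisson_kernel_measurable [measurable]:
  assumes [measurable]: "f \<in> borel_measurable M" "g \<in> borel_measurable M" "k \<in> borel_measurable M"
  shows "(\<lambda>w. poisson_kernel (f w) (g w) (k w)) \<in> borel_measurable M"
  unfolding poisson_kernel_def by measurable

lemma nn_integral_poisson_kernel:
  assumes "0 < y"
  shows "(\<integral>\<^sup>+ t. ennreal (poisson_kernel x y t) \<partial>lborel) = 1"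
proof -
  \<comment> \<open>The substitution \<open>t = x + y * s\<close> turns every kernel into a rescaled
    \<open>1 / (1 + s^2)\<close>; the Jacobian \<open>y\<close> cancels the factor
    \<open>1 / y\<close>.\<close>
  have *: "poisson_kernel x y (x + y * s) = (1 / (pi * y)) * (1 / (1 + s\<^sup>2))" for s
  proof -
    have "y\<^sup>2 + (x + y * s - x)\<^sup>2 = y * (y * (1 + s\<^sup>2))"
      by (simp add: power2_eq_square algebra_simps)
    then show ?thesis
      unfolding poisson_kernel_def using assms by simp
  qed
  have "(\<integral>\<^sup>+ t. ennreal (poisson_kernel x y t) \<partial>lborel)
      = ennreal y * (\<integral>\<^sup>+ s. ennreal (1 / (pi * y)) * ennreal (1 / (1 + s\<^sup>2)) \<partial>lborel)"
    using assms by (subst nn_integral_real_affine[where c = y and t = x]) (auto simp: * ennreal_mult[symmetric])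
  also have "\<dots> = ennreal y * (ennreal (1 / (pi * y)) * ennreal pi)"
    by (subst nn_integral_cmult) (auto simp: nn_integral_inverse_1_plus_square)
  also have "\<dots> = 1"
    using assms by (simp flip: ennreal_mult)
  finally show ?thesis .
qed

section \<open>Regularity of finite measures on the half-plane\<close>

lemma open_upper_half_plane: "open upper_half_plane"
  unfolding upper_half_plane_def case_prod_beta by (intro open_Collect_less continuous_intros)

lemma upper_half_plane_borel [measurable]: "upper_half_plane \<in> sets borel"
  using open_upper_half_plane by simp

text \<open>Finite Borel measures on the plane are inner and outer regular. Compact subsets of
  \<open>A\<close> already lie in the half-plane, and an open superset of \<open>A\<close> can be
  cut down to the half-plane because the latter is open.\<close>

lemma regular_borel_measure_restrict:
  fixes M :: "(real \<times> real) measure"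
  assumes "finite_measure M" and sets: "sets M = sets borel"
  shows "regular_borel_measure (restrict_space M upper_half_plane)"
proof -
  interpret finite_measure M by fact
  let ?R = "restrict_space M upper_half_plane"
  have U: "upper_half_plane \<inter> space M \<in> sets M"
    using sets_eq_imp_space_eq[OF sets] by (simp add: sets)
  have em: "emeasure ?R A = emeasure M A" if "A \<subseteq> upper_half_plane" for A
    using emeasure_restrict_space[OF U that] .
  have A: "A \<subseteq> upper_half_plane \<and> A \<in> sets borel" if "A \<in> sets ?R" for A
    using that by (simp add: sets_restrict_space_iff[OF U] sets)
  show ?thesis
    unfolding regular_borel_measure_def
  proof (intro conjI ballI allI impI)
    show "sets ?R = sets (restrict_space borel upper_half_plane)"
      by (rule sets_restrict_space_cong[OF sets])
    show "emeasure ?R K < \<infinity>" if "compact K \<and> K \<subseteq> upper_half_plane" for K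
      using that by (simp add: em less_top[symmetric])
    fix A assume "A \<in> sets ?R"
    note A = A[OF this]
    show "emeasure ?R A = (SUP K\<in>{K. compact K \<and> K \<subseteq> A}. emeasure ?R K)"
    proof -
      have "emeasure M A = (SUP K\<in>{K. K \<subseteq> A \<and> compact K}. emeasure M K)"
        using A sets by (intro inner_regular) auto
      also have "\<dots> = (SUP K\<in>{K. compact K \<and> K \<subseteq> A}. emeasure ?R K)"
        using A em by (intro SUP_cong) auto
      finally show ?thesis using A em by simp
    qed
    show "emeasure ?R A =
      (INF U\<in>{U. open U \<and> A \<subseteq> U \<and> U \<subseteq> upper_half_plane}. emeasure ?R U)"
    proof (rule antisym)
      show "emeasure ?R A \<le> (INF U\<in>{U. open U \<and> A \<subseteq> U \<and> U \<subseteq> upper_half_plane}. emeasure ?R U)"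
        by (auto intro!: INF_greatest emeasure_mono simp: sets_restrict_space_iff[OF U] sets)
      have "emeasure M A = (INF U\<in>{U. A \<subseteq> U \<and> open U}. emeasure M U)"
        using A sets by (intro outer_regular) auto
      also have "(INF U\<in>{U. open U \<and> A \<subseteq> U \<and> U \<subseteq> upper_half_plane}. emeasure ?R U) \<le> \<dots>"
      proof (rule INF_mono)
        fix V assume V: "V \<in> {U. A \<subseteq> U \<and> open U}"
        show "\<exists>W\<in>{U. open U \<and> A \<subseteq> U \<and> U \<subseteq> upper_half_plane}. emeasure ?R W \<le> emeasure M V"
          using V A open_upper_half_plane
          by (intro bexI[of _ "V \<inter> upper_half_plane"])
             (auto simp: em sets open_Int intro!: emeasure_mono)
      qed
      finally show "(INF U\<in>{U. open U \<and> A \<subseteq> U \<and> U \<subseteq> upper_half_plane}. emeasure ?R U) \<le> emeasure ?R A"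
        using A em by simp
    qed
  qed
qed

section \<open>Mean oscillation from one-sided bounds\<close>

text \<open>If \<open>b - c\<close> is nonnegative on \<open>I\<close> with mean \<open>d\<close> at
  most \<delta>, then the mean of \<open>b\<close> is \<open>c + d\<close>, and the distance of
  \<open>b\<close> from it is at most \<open>(b - c) + d\<close>. Both terms have mean at most
  \<delta>, whence the factor 2.\<close>

lemma BMO_norm_le:
  fixes b :: "real \<Rightarrow> real"
  assumes [measurable]: "b \<in> borel_measurable borel" and "0 \<le> \<delta>"
    and osc: "\<And>I. I \<in> bounded_intervals \<Longrightarrow> \<exists>c. (\<forall>t\<in>I. c \<le> b t) \<and>
      (\<integral>\<^sup>+ t\<in>I. ennreal (b t - c) \<partial>lborel) \<le> ennreal (\<delta> * len I)"
  shows "BMO_norm b \<le> ennreal (2 * \<delta>)"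
  unfolding BMO_norm_def
proof (rule SUP_least)
  fix I assume I: "I \<in> bounded_intervals"
  obtain x y where "x < y" and sub: "I \<subseteq> {x..y}" and l: "len I = y - x" and [measurable]: "I \<in> sets borel"
    using bounded_intervals_enclosure[OF I] .
  have lpos: "0 < len I" using l \<open>x < y\<close> by simp
  have "emeasure lborel I \<le> emeasure lborel {x..y}" using sub by (intro emeasure_mono) auto
  also have "\<dots> < \<infinity>" using \<open>x < y\<close> by simp
  finally have fin: "emeasure lborel I < \<infinity>" .
  have em: "emeasure lborel I = ennreal (len I)"
    unfolding len_def using fin by (intro emeasure_eq_ennreal_measure) auto
  obtain c where c: "\<And>t. t \<in> I \<Longrightarrow> c \<le> b t"
    and le: "(\<integral>\<^sup>+ t\<in>I. ennreal (b t - c) \<partial>lborel) \<le> ennreal (\<delta> * len I)"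
    using osc[OF I] by blast
  define g where "g t = indicator I t * (b t - c)" for t
  have [measurable]: "g \<in> borel_measurable lborel" unfolding g_def by measurable
  have g0: "0 \<le> g t" for t using c by (auto simp: g_def indicator_def)
  have gI: "(\<integral>\<^sup>+ t. ennreal (g t) \<partial>lborel) \<le> ennreal (\<delta> * len I)"
  proof -
    have "(\<integral>\<^sup>+ t. ennreal (g t) \<partial>lborel) = (\<integral>\<^sup>+ t\<in>I. ennreal (b t - c) \<partial>lborel)"
      by (intro nn_integral_cong) (auto simp: g_def indicator_def)
    with le show ?thesis by simp
  qed
  \<comment> \<open>Integrability of \<open>g\<close> and of the constant on \<open>I\<close>
    ensures that \<open>avg b I\<close> is the true mean, not the default value 0.\<close>
  have gi: "integrable lborel g"
    using g0 gI by (intro integrableI_nonneg) (auto simp: top_unique less_top[symmetric])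
  have ci: "integrable lborel (\<lambda>t. indicator I t * c)"
    using fin by (intro integrable_mult_left integrable_real_indicator) auto
  define d where "d = (1 / len I) * integral\<^sup>L lborel g"
  have "integral\<^sup>L lborel g \<le> \<delta> * len I"
    using gI g0 \<open>0 \<le> \<delta>\<close> lpos by (simp add: nn_integral_eq_integral[OF gi])
  then have d: "0 \<le> d" "d \<le> \<delta>"
    using lpos g0 by (auto simp: d_def field_simps intro!: Bochner_Integration.integral_nonneg)
  have "(LINT t:I|lborel. b t) = (LINT t|lborel. g t + indicator I t * c)"
    unfolding set_lebesgue_integral_def by (intro Bochner_Integration.integral_cong) (auto simp: g_def indicator_def)
  also have "\<dots> = integral\<^sup>L lborel g + len I * c"
    using gi ci fin by (subst Bochner_Integration.integral_add) (auto simp: len_def)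
  finally have avg: "avg b I = c + d"
    using lpos by (simp add: avg_def d_def field_simps)
  have "(\<integral>\<^sup>+ t\<in>I. ennreal \<bar>b t - avg b I\<bar> \<partial>lborel)
      \<le> (\<integral>\<^sup>+ t. ennreal (g t) + ennreal d * indicator I t \<partial>lborel)"
  proof (rule nn_integral_mono)
    fix t show "ennreal \<bar>b t - avg b I\<bar> * indicator I t \<le> ennreal (g t) + ennreal d * indicator I t"
      using c[of t] d by (auto simp: g_def avg indicator_def simp flip: ennreal_plus intro!: ennreal_leI)
  qed
  also have "\<dots> = (\<integral>\<^sup>+ t. ennreal (g t) \<partial>lborel) + ennreal d * emeasure lborel I"
    by (subst nn_integral_add) (auto simp: nn_integral_cmult)
  also have "\<dots> \<le> ennreal (\<delta> * len I) + ennreal \<delta> * ennreal (len I)"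
    using gI d unfolding em by (intro add_mono mult_right_mono ennreal_leI) auto
  also have "\<dots> = ennreal (2 * \<delta> * len I)"
    using lpos \<open>0 \<le> \<delta>\<close> by (simp flip: ennreal_mult ennreal_plus)
  finally have "ennreal (1 / len I) * (\<integral>\<^sup>+ t\<in>I. ennreal \<bar>b t - avg b I\<bar> \<partial>lborel)
      \<le> ennreal (1 / len I) * ennreal (2 * \<delta> * len I)"
    by (intro mult_left_mono) auto
  also have "\<dots> = ennreal (2 * \<delta>)"
    using lpos \<open>0 \<le> \<delta>\<close> by (simp flip: ennreal_mult)
  finally show "ennreal (1 / len I) * (\<integral>\<^sup>+ t\<in>I. ennreal \<bar>b t - avg b I\<bar> \<partial>lborel) \<le> ennreal (2 * \<delta>)" .
qed

section \<open>Oscillation of the step function\<close>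

text \<open>The surviving terms form a geometric series with ratio 1/2 whose first term is below
  \<open>M\<close>. The induction drops leading terms, replacing \<open>r\<close> by
  \<open>r/2\<close>, until \<open>r < M\<close>.\<close>

lemma sum_halvings_below:
  fixes r M :: real
  assumes "0 < r" "0 \<le> M"
  shows "(\<Sum>k<N. if r / 2^k < M then r / 2^k else 0) \<le> 2 * M"
  using assms
proof (induction N arbitrary: r)
  case (Suc N)
  show ?case
  proof (cases "r < M")
    case True
    have "(\<Sum>k<Suc N. if r / 2^k < M then r / 2^k else 0) \<le> (\<Sum>k<Suc N. r * (1/2)^k)"
      using Suc.prems by (intro sum_mono) (auto simp: power_divide)
    also have "\<dots> = r * (2 - 2 * (1/2)^Suc N)"
      by (simp only: sum_distrib_left[symmetric] sum_gp_strict) simp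
    also have "\<dots> \<le> r * 2" using Suc.prems by (intro mult_left_mono) auto
    finally show ?thesis using True by linarith
  next
    case False
    have "r / 2 ^ Suc k = r / 2 / 2 ^ k" for k by simp
    then show ?thesis
      using False Suc.IH[of "r/2"] Suc.prems
      by (simp only: sum.lessThan_Suc_shift) simp
  qed
qed simp

definition dyadic_steps :: "nat \<Rightarrow> real \<Rightarrow> real \<Rightarrow> real" where
  "dyadic_steps N r x = (\<Sum>k<N. indicator {- (r / 2^k)..r / 2^k} x) / real N"

lemma dyadic_steps_measurable [measurable]: "dyadic_steps N r \<in> borel_measurable borel"
  unfolding dyadic_steps_def by measurable

lemma dyadic_steps_nonneg: "0 \<le> dyadic_steps N r x"
  by (auto simp: dyadic_steps_def intro!: divide_nonneg_nonneg sum_nonneg)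

lemma dyadic_steps_le:
  assumes "0 < r"
  shows "dyadic_steps N r x \<le> indicator {-r..r} x"
proof -
  have "(\<Sum>k<N. indicator {- (r / 2^k)..r / 2^k} x :: real) \<le> (\<Sum>k<N. indicator {-r..r} x)"
  proof (rule sum_mono)
    fix k
    have "r / 2^k \<le> r" using assms by (simp add: field_simps)
    then show "(indicator {- (r / 2^k)..r / 2^k} x :: real) \<le> indicator {-r..r} x"
      by (auto simp: indicator_def)
  qed
  then show ?thesis
    by (cases "N = 0") (auto simp: dyadic_steps_def field_simps)
qed

lemma dyadic_steps_le_1: "0 < r \<Longrightarrow> dyadic_steps N r x \<le> 1"
  using dyadic_steps_le[of r N x] by (auto simp: indicator_def of_bool_def split: if_splits)

text \<open>The innermost of the \<open>n + 1\<close> nested intervals has radius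
  \<open>r / 2^n\<close>, so on it all indicators equal 1. This plateau is what forces the Carleson
  constant up to 1.\<close>

lemma dyadic_steps_eq_1:
  assumes "0 < r" "\<bar>x\<bar> \<le> r / 2^n"
  shows "dyadic_steps (Suc n) r x = 1"
proof -
  have "(\<Sum>k<Suc n. indicator {- (r / 2^k)..r / 2^k} x) = (\<Sum>k<Suc n. 1 :: real)"
  proof (rule sum.cong)
    fix k assume "k \<in> {..<Suc n}"
    then have "(2::real)^k \<le> 2^n" by (intro power_increasing) auto
    then have "r / 2^n \<le> r / 2^k" using assms by (intro divide_left_mono) auto
    then show "(indicator {- (r / 2^k)..r / 2^k} x :: real) = 1"
      using assms by (auto simp: indicator_def)
  qed simp
  then show ?thesis by (simp add: dyadic_steps_def del: sum.lessThan_Suc)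
qed

lemma dyadic_steps_antimono:
  assumes "\<bar>x\<bar> \<le> \<bar>y\<bar>"
  shows "dyadic_steps N r y \<le> dyadic_steps N r x"
  unfolding dyadic_steps_def using assms
  by (intro divide_right_mono sum_mono) (auto simp: indicator_def)

text \<open>An interval shorter than \<open>M / 2\<close> with an endpoint at distance
  \<open>M\<close> from 0 stays at distance more than \<open>M / 2\<close> from 0; if it meets
  \<open>{-\<rho>..\<rho>}\<close>, then \<open>4 * \<rho> / M\<close> exceeds 1 and the bound is
  trivial. For a longer interval, the total length \<open>2 * \<rho>\<close> of
  \<open>{-\<rho>..\<rho>}\<close> is already small enough.\<close>

lemma emeasure_Icc_Int_centred:
  fixes a b \<rho> :: real
  defines "M \<equiv> max \<bar>a\<bar> \<bar>b\<bar>"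
  assumes "a < b" "0 < \<rho>" "\<rho> < M"
  shows "emeasure lborel ({a..b} \<inter> {-\<rho>..\<rho>}) \<le> ennreal (4 * \<rho> / M * (b - a))"
proof (cases "{a..b} \<inter> {-\<rho>..\<rho>} = {}")
  case False
  have "emeasure lborel ({a..b} \<inter> {-\<rho>..\<rho>}) = ennreal (min b \<rho> - max a (-\<rho>))"
    using False assms by (simp add: Int_atLeastAtMost)
  also have "min b \<rho> - max a (-\<rho>) \<le> 4 * \<rho> / M * (b - a)"
  proof (cases "b - a < M / 2")
    case True
    then have "1 \<le> 4 * \<rho> / M"
      using False assms by (auto simp: M_def max_def field_simps abs_if split: if_splits)
    then have "1 * (b - a) \<le> 4 * \<rho> / M * (b - a)"
      using assms by (intro mult_right_mono) auto
    then show ?thesis by (simp add: min_def max_def)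
  next
    case F: False
    have "2 * \<rho> = 4 * \<rho> / M * (M / 2)" using assms by (simp add: field_simps)
    also have "\<dots> \<le> 4 * \<rho> / M * (b - a)" using F assms by (intro mult_left_mono) auto
    finally show ?thesis by linarith
  qed
  finally show ?thesis by (simp add: ennreal_leI)
qed simp

text \<open>Steps of radius at least \<open>M\<close> are constant on \<open>{a..b}\<close> and
  cancel. A step of smaller radius \<open>\<rho> k\<close> contributes at most
  \<open>4 * \<rho> k / (N * M)\<close> times the length, and these radii sum to at most
  \<open>2 * M\<close>. Hence the bound 8/N, uniform in the interval and in
  \<open>r\<close>.\<close>

lemma dyadic_steps_oscillation:
  fixes a b :: real
  assumes "a < b" "0 < r" "0 < N"
  shows "(\<integral>\<^sup>+ t\<in>{a..b}. ennreal (dyadic_steps N r t - dyadic_steps N r (max \<bar>a\<bar> \<bar>b\<bar>)) \<partial>lborel)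
    \<le> ennreal (8 / real N * (b - a))"
proof -
  define M where "M = max \<bar>a\<bar> \<bar>b\<bar>"
  have M: "0 < M" using \<open>a < b\<close> by (auto simp: M_def)
  define \<rho> where "\<rho> k = r / 2^k" for k :: nat
  have \<rho>: "0 < \<rho> k" for k using assms by (simp add: \<rho>_def)
  have "(\<integral>\<^sup>+ t\<in>{a..b}. ennreal (dyadic_steps N r t - dyadic_steps N r M) \<partial>lborel)
      \<le> (\<integral>\<^sup>+ t. (\<Sum>k<N. ennreal (of_bool (\<rho> k < M) / real N) * indicator ({a..b} \<inter> {-\<rho> k..\<rho> k}) t) \<partial>lborel)"
  proof (rule nn_integral_mono)
    fix t
    show "ennreal (dyadic_steps N r t - dyadic_steps N r M) * indicator {a..b} t
      \<le> (\<Sum>k<N. ennreal (of_bool (\<rho> k < M) / real N) * indicator ({a..b} \<inter> {-\<rho> k..\<rho> k}) t)"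
    proof (cases "t \<in> {a..b}")
      case True
      then have "\<bar>t\<bar> \<le> M" by (auto simp: M_def)
      \<comment> \<open>If \<open>\<rho> k < M\<close>, the indicator vanishes at \<open>M\<close>;
        otherwise it equals 1 at both \<open>t\<close> and \<open>M\<close>.\<close>
      then have "dyadic_steps N r t - dyadic_steps N r M
          = (\<Sum>k<N. of_bool (\<rho> k < M) / real N * indicator {-\<rho> k..\<rho> k} t)"
        unfolding dyadic_steps_def \<rho>_def[symmetric] diff_divide_distrib[symmetric]
          sum_subtractf[symmetric] sum_divide_distrib
        using M by (intro sum.cong) (auto simp: indicator_def)
      also have "ennreal \<dots> = (\<Sum>k<N. ennreal (of_bool (\<rho> k < M) / real N * indicator {-\<rho> k..\<rho> k} t))"
        by (intro sum_ennreal[symmetric]) auto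
      also have "\<dots> = (\<Sum>k<N. ennreal (of_bool (\<rho> k < M) / real N) * indicator {-\<rho> k..\<rho> k} t)"
        by (intro sum.cong) (auto simp: indicator_def)
      finally show ?thesis using True by (simp add: indicator_inter_arith)
    qed simp
  qed
  also have "\<dots> = (\<Sum>k<N. ennreal (of_bool (\<rho> k < M) / real N) * emeasure lborel ({a..b} \<inter> {-\<rho> k..\<rho> k}))"
    by (subst nn_integral_sum) (auto simp: nn_integral_cmult simp del: Int_atLeastAtMost)
  also have "\<dots> \<le> (\<Sum>k<N. ennreal (4 / (real N * M) * (b - a) * (if \<rho> k < M then \<rho> k else 0)))"
  proof (rule sum_mono)
    fix k
    show "ennreal (of_bool (\<rho> k < M) / real N) * emeasure lborel ({a..b} \<inter> {-\<rho> k..\<rho> k})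
      \<le> ennreal (4 / (real N * M) * (b - a) * (if \<rho> k < M then \<rho> k else 0))"
    proof (cases "\<rho> k < M")
      case True
      have "ennreal (1 / real N) * emeasure lborel ({a..b} \<inter> {-\<rho> k..\<rho> k})
          \<le> ennreal (1 / real N) * ennreal (4 * \<rho> k / M * (b - a))"
        using emeasure_Icc_Int_centred[OF \<open>a < b\<close> \<rho>, of k] True
        by (intro mult_left_mono) (auto simp: M_def)
      also have "\<dots> = ennreal (4 / (real N * M) * (b - a) * \<rho> k)"
        using assms M \<rho>[of k] by (subst ennreal_mult[symmetric]) (auto simp: field_simps)
      finally show ?thesis using True by simp
    qed simp
  qed
  also have "\<dots> = ennreal (4 / (real N * M) * (b - a) * (\<Sum>k<N. if \<rho> k < M then \<rho> k else 0))"
    unfolding sum_distrib_left using assms M less_imp_le[OF \<rho>] by (intro sum_ennreal) auto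
  also have "\<dots> \<le> ennreal (4 / (real N * M) * (b - a) * (2 * M))"
    unfolding \<rho>_def using assms M
    by (intro ennreal_leI mult_left_mono sum_halvings_below) auto
  also have "4 / (real N * M) * (b - a) * (2 * M) = 8 / real N * (b - a)"
    using M by (simp only: times_divide_eq_left times_divide_eq_right) (simp add: divide_simps)
  finally show ?thesis by (simp add: M_def)
qed

section \<open>Averaging over translations\<close>

text \<open>For each shift \<open>u\<close>, \<open>dyadic_steps N r (M u)\<close> bounds the
  translate from below on \<open>{a..b}\<close>; its average over \<kappa> serves as
  \<open>c\<close>. The integrand is then nonnegative, so the integrals can be exchanged, and the
  inner one is the oscillation over the shifted interval \<open>{a - u..b - u}\<close>, bounded
  independently of \<open>u\<close>.\<close>

lemma convolution_oscillation:
  fixes \<kappa> :: "real measure"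
  assumes "prob_space \<kappa>" and sets [measurable_cong, simp]: "sets \<kappa> = sets borel"
    and "0 < r" "0 < N" and I: "I \<in> bounded_intervals"
  shows "\<exists>c. (\<forall>t\<in>I. c \<le> (\<integral>u. dyadic_steps N r (t - u) \<partial>\<kappa>)) \<and>
    (\<integral>\<^sup>+ t\<in>I. ennreal ((\<integral>u. dyadic_steps N r (t - u) \<partial>\<kappa>) - c) \<partial>lborel) \<le> ennreal (8 / real N * len I)"
proof -
  interpret \<kappa>: prob_space \<kappa> by fact
  interpret pair_sigma_finite lborel \<kappa> ..
  let ?\<phi> = "dyadic_steps N r"
  obtain a b where "a < b" and sub: "I \<subseteq> {a..b}" and l: "len I = b - a" and [measurable]: "I \<in> sets borel"
    using bounded_intervals_enclosure[OF I] .
  define M where "M u = max \<bar>a - u\<bar> \<bar>b - u\<bar>" for u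
  have [measurable]: "M \<in> borel_measurable borel" unfolding M_def by measurable
  define c where "c = (\<integral>u. ?\<phi> (M u) \<partial>\<kappa>)"
  have int: "integrable \<kappa> (\<lambda>u. ?\<phi> (f u))" if [measurable]: "f \<in> borel_measurable borel" for f
    using \<open>0 < r\<close> by (intro \<kappa>.integrable_const_bound[where B = 1])
      (auto simp: dyadic_steps_nonneg dyadic_steps_le_1)
  have mono: "?\<phi> (M u) \<le> ?\<phi> (t - u)" if "t \<in> {a..b}" for t u
    using that by (intro dyadic_steps_antimono) (auto simp: M_def)
  have diff: "(\<integral>u. ?\<phi> (t - u) \<partial>\<kappa>) - c = (\<integral>u. ?\<phi> (t - u) - ?\<phi> (M u) \<partial>\<kappa>)" for t
    unfolding c_def by (intro Bochner_Integration.integral_diff[symmetric] int) measurable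
  have ge: "c \<le> (\<integral>u. ?\<phi> (t - u) \<partial>\<kappa>)" if "t \<in> I" for t
    unfolding c_def using mono that sub by (intro integral_mono int) auto
  have "(\<integral>\<^sup>+ t\<in>I. ennreal ((\<integral>u. ?\<phi> (t - u) \<partial>\<kappa>) - c) \<partial>lborel)
      \<le> (\<integral>\<^sup>+ t. (\<integral>\<^sup>+ u. ennreal (?\<phi> (t - u) - ?\<phi> (M u)) * indicator {a..b} t \<partial>\<kappa>) \<partial>lborel)"
  proof (rule nn_integral_mono)
    fix t
    show "ennreal ((\<integral>u. ?\<phi> (t - u) \<partial>\<kappa>) - c) * indicator I t
      \<le> (\<integral>\<^sup>+ u. ennreal (?\<phi> (t - u) - ?\<phi> (M u)) * indicator {a..b} t \<partial>\<kappa>)"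
    proof (cases "t \<in> I")
      case True
      then have t: "t \<in> {a..b}" using sub by auto
      have "(\<integral>\<^sup>+ u. ennreal (?\<phi> (t - u) - ?\<phi> (M u)) \<partial>\<kappa>) = ennreal (\<integral>u. ?\<phi> (t - u) - ?\<phi> (M u) \<partial>\<kappa>)"
        using mono[OF t] by (intro nn_integral_eq_integral Bochner_Integration.integrable_diff int) auto
      then show ?thesis using t True by (simp add: diff)
    qed simp
  qed
  also have "\<dots> = (\<integral>\<^sup>+ u. (\<integral>\<^sup>+ t. ennreal (?\<phi> (t - u) - ?\<phi> (M u)) * indicator {a..b} t \<partial>lborel) \<partial>\<kappa>)"
    by (rule Fubini'[symmetric]) measurable
  also have "\<dots> \<le> (\<integral>\<^sup>+ u. ennreal (8 / real N * len I) \<partial>\<kappa>)"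
  proof (rule nn_integral_mono)
    fix u
    have "(\<integral>\<^sup>+ t. ennreal (?\<phi> (t - u) - ?\<phi> (M u)) * indicator {a..b} t \<partial>lborel)
        = (\<integral>\<^sup>+ s. ennreal (?\<phi> s - ?\<phi> (M u)) * indicator {a - u..b - u} s \<partial>lborel)"
      by (subst nn_integral_real_affine[where c = 1 and t = u])
         (auto simp: indicator_def intro!: nn_integral_cong)
    also have "\<dots> \<le> ennreal (8 / real N * ((b - u) - (a - u)))"
      unfolding M_def using \<open>a < b\<close> assms by (intro dyadic_steps_oscillation) auto
    finally show "(\<integral>\<^sup>+ t. ennreal (?\<phi> (t - u) - ?\<phi> (M u)) * indicator {a..b} t \<partial>lborel)
      \<le> ennreal (8 / real N * len I)" by (simp add: l)
  qed
  also have "\<dots> = ennreal (8 / real N * len I)"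
    by (simp add: \<kappa>.emeasure_space_1)
  finally show ?thesis using ge by blast
qed

section \<open>Measures on a horizontal line and their balayage\<close>

text \<open>The push-forward lives on the whole plane; the restriction gives the sigma-algebra
  demanded by \<open>regular_borel_measure\<close> and loses no mass when
  \<open>0 < h\<close>.\<close>

definition line_measure :: "(real \<Rightarrow> real) \<Rightarrow> real \<Rightarrow> (real \<times> real) measure" where
  "line_measure \<phi> h = restrict_space (distr (density lborel (\<lambda>x. ennreal (\<phi> x))) borel (\<lambda>x. (x, h))) upper_half_plane"

lemma measurable_horizontal_line [measurable]: "(\<lambda>x::real. (x, h::real)) \<in> borel_measurable borel"
  by (intro borel_measurable_continuous_onI continuous_intros)

lemma nn_integral_line_measure:
  assumes [measurable]: "\<phi> \<in> borel_measurable borel" "f \<in> borel_measurable borel" and "0 < h"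
  shows "(\<integral>\<^sup>+ z. f z \<partial>line_measure \<phi> h) = (\<integral>\<^sup>+ x. ennreal (\<phi> x) * f (x, h) \<partial>lborel)"
proof -
  have "(\<integral>\<^sup>+ z. f z \<partial>line_measure \<phi> h)
      = (\<integral>\<^sup>+ x. ennreal (\<phi> x) * (f (x, h) * indicator upper_half_plane (x, h)) \<partial>lborel)"
    unfolding line_measure_def
    by (simp add: nn_integral_restrict_space nn_integral_distr nn_integral_density)
  then show ?thesis using \<open>0 < h\<close> by (simp add: upper_half_plane_def)
qed

lemma emeasure_line_measure:
  assumes [measurable]: "\<phi> \<in> borel_measurable borel" "A \<in> sets borel" and "A \<subseteq> upper_half_plane" "0 < h"
  shows "emeasure (line_measure \<phi> h) A = (\<integral>\<^sup>+ x. ennreal (\<phi> x) * indicator A (x, h) \<partial>lborel)"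
proof -
  have "A \<in> sets (line_measure \<phi> h)"
    using assms by (simp add: line_measure_def sets_restrict_space_iff)
  then have "emeasure (line_measure \<phi> h) A = (\<integral>\<^sup>+ z. indicator A z \<partial>line_measure \<phi> h)"
    by simp
  also have "\<dots> = (\<integral>\<^sup>+ x. ennreal (\<phi> x) * indicator A (x, h) \<partial>lborel)"
    using assms by (intro nn_integral_line_measure) auto
  finally show ?thesis .
qed

lemma regular_line_measure:
  assumes [measurable]: "\<phi> \<in> borel_measurable borel" and "(\<integral>\<^sup>+ x. ennreal (\<phi> x) \<partial>lborel) < \<infinity>"
  shows "regular_borel_measure (line_measure \<phi> h)"
  unfolding line_measure_def using assms
  by (intro regular_borel_measure_restrict finite_measureI)
     (auto simp: emeasure_distr emeasure_density)

text \<open>A Carleson square meets the line at height \<open>h\<close> in all of \<open>I\<close>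
  or not at all, according to whether \<open>h \<le> len I\<close>.\<close>

lemma emeasure_line_measure_carleson_square:
  assumes [measurable]: "\<phi> \<in> borel_measurable borel" "I \<in> sets borel" and "0 < h"
  shows "emeasure (line_measure \<phi> h) (carleson_square I)
    = (\<integral>\<^sup>+ x\<in>I. ennreal (\<phi> x) * of_bool (h \<le> len I) \<partial>lborel)"
proof -
  have "carleson_square I = I \<times> {0<..len I}"
    by (auto simp: carleson_square_def)
  then have "carleson_square I \<in> sets borel"
    by (simp add: borel_prod[symmetric])
  moreover have "carleson_square I \<subseteq> upper_half_plane"
    by (auto simp: carleson_square_def upper_half_plane_def)
  ultimately show ?thesis
    using assms by (subst emeasure_line_measure)
      (auto intro!: nn_integral_cong simp: carleson_square_def indicator_def)
qed

lemma balayage_line_measure: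
  assumes [measurable]: "\<phi> \<in> borel_measurable borel" and "0 < h"
  shows "balayage (line_measure \<phi> h) t = (\<integral>\<^sup>+ x. ennreal (\<phi> x) * ennreal (poisson_kernel x h t) \<partial>lborel)"
proof -
  have "(\<lambda>z. poisson_kernel (fst z) (snd z) t) \<in> borel_measurable borel"
    unfolding borel_prod[symmetric] by measurable
  then show ?thesis
    unfolding balayage_def using assms
    by (subst nn_integral_line_measure) (auto simp: case_prod_beta)
qed

text \<open>By Tonelli, since each Poisson kernel has integral 1 in \<open>t\<close>, balayage
  preserves the total mass.\<close>

lemma balayage_L1_norm_line_measure:
  assumes [measurable]: "\<phi> \<in> borel_measurable borel" and "0 < h"
  shows "balayage_L1_norm (line_measure \<phi> h) = (\<integral>\<^sup>+ x. ennreal (\<phi> x) \<partial>lborel)"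
proof -
  have "balayage_L1_norm (line_measure \<phi> h)
      = (\<integral>\<^sup>+ x. (\<integral>\<^sup>+ t. ennreal (\<phi> x) * ennreal (poisson_kernel x h t) \<partial>lborel) \<partial>lborel)"
    unfolding balayage_L1_norm_def balayage_line_measure[OF assms]
    by (intro lborel_pair.Fubini') measurable
  also have "\<dots> = (\<integral>\<^sup>+ x. ennreal (\<phi> x) \<partial>lborel)"
    using \<open>0 < h\<close> by (simp add: nn_integral_cmult nn_integral_poisson_kernel)
  finally show ?thesis .
qed

lemma prob_space_poisson_kernel:
  "0 < h \<Longrightarrow> prob_space (density lborel (\<lambda>u. ennreal (poisson_kernel 0 h u)))"
  by (intro prob_spaceI) (auto simp: emeasure_density nn_integral_poisson_kernel)

text \<open>At fixed height the kernel depends only on \<open>t - x\<close>, so substituting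
  \<open>x = t - u\<close> exhibits an average of translates against a probability measure.\<close>

lemma balayage_line_measure_convolution:
  assumes [measurable]: "\<phi> \<in> borel_measurable borel" and "0 < h"
  shows "balayage (line_measure \<phi> h) t
    = (\<integral>\<^sup>+ u. ennreal (\<phi> (t - u)) \<partial>density lborel (\<lambda>u. ennreal (poisson_kernel 0 h u)))"
proof -
  have "poisson_kernel (t - u) h t = poisson_kernel 0 h u" for u
    by (simp add: poisson_kernel_def)
  then have "balayage (line_measure \<phi> h) t
      = (\<integral>\<^sup>+ u. ennreal (\<phi> (t - u)) * ennreal (poisson_kernel 0 h u) \<partial>lborel)"
    unfolding balayage_line_measure[OF assms]
    by (subst nn_integral_real_affine[where c = "-1" and t = t]) auto
  then show ?thesis
    by (simp add: nn_integral_density mult.commute)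
qed

text \<open>Since \<phi> has values in [0, 1], so do its averages; the balayage is therefore finite
  everywhere and \<open>enn2real\<close> loses nothing.\<close>

lemma real_balayage_line_measure:
  assumes [measurable]: "\<phi> \<in> borel_measurable borel" and "0 < h" and "\<And>x. 0 \<le> \<phi> x" "\<And>x. \<phi> x \<le> 1"
  defines "\<kappa> \<equiv> density lborel (\<lambda>u. ennreal (poisson_kernel 0 h u))"
  shows "real_balayage (line_measure \<phi> h) t = (\<integral>u. \<phi> (t - u) \<partial>\<kappa>)"
    and "balayage (line_measure \<phi> h) t = ennreal (real_balayage (line_measure \<phi> h) t)"
    and "real_balayage (line_measure \<phi> h) t \<in> {0..1}"
proof -
  interpret prob_space \<kappa> unfolding \<kappa>_def using \<open>0 < h\<close> by (rule prob_space_poisson_kernel)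
  have [measurable_cong]: "sets \<kappa> = sets borel" by (simp add: \<kappa>_def)
  have int: "integrable \<kappa> (\<lambda>u. \<phi> (t - u))"
    using assms by (intro integrable_const_bound[where B = 1]) auto
  have nonneg: "0 \<le> (\<integral>u. \<phi> (t - u) \<partial>\<kappa>)" using assms by (intro Bochner_Integration.integral_nonneg) auto
  have eq: "balayage (line_measure \<phi> h) t = ennreal (\<integral>u. \<phi> (t - u) \<partial>\<kappa>)"
    unfolding balayage_line_measure_convolution[OF assms(1,2)] \<kappa>_def[symmetric]
    using int assms by (intro nn_integral_eq_integral) auto
  then show *: "real_balayage (line_measure \<phi> h) t = (\<integral>u. \<phi> (t - u) \<partial>\<kappa>)"
    using nonneg by (simp add: real_balayage_def)
  show "balayage (line_measure \<phi> h) t = ennreal (real_balayage (line_measure \<phi> h) t)"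
    unfolding eq * ..
  have "(\<integral>u. \<phi> (t - u) \<partial>\<kappa>) \<le> 1"
    using int assms by (intro integral_le_const) auto
  then show "real_balayage (line_measure \<phi> h) t \<in> {0..1}"
    using nonneg * by simp
qed

section \<open>Choice of parameters and verification\<close>

theorem theorem4p2:
  fixes \<epsilon> :: real
  assumes "\<epsilon> > 0"
  shows "\<exists>\<mu>. carleson_measure \<mu> \<and> Carl \<mu> = 1 \<and>
           real_balayage \<mu> \<in> BMO \<and>
           BMO_norm (real_balayage \<mu>) + balayage_L1_norm \<mu> < ennreal \<epsilon>"
proof -
  \<comment> \<open>\<open>m\<close> makes the mass bound \<open>2 * r\<close> less than
    \<epsilon>/2; \<open>n\<close> makes the oscillation bound \<open>16 / (n + 1)\<close> less than
    \<epsilon>/2. Taking \<open>r\<close> to be a power of 1/2 makes \<open>h = r / 2^n\<close> one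
    too, so that \<open>{0<..h}\<close> is dyadic.\<close>
  obtain m where m: "(1/2)^m < \<epsilon> / 4"
    using real_arch_pow_inv[of "\<epsilon>/4" "1/2"] assms by auto
  obtain n where n: "32 / \<epsilon> < real n" using reals_Archimedean2 by blast
  define r h \<phi> \<mu> where "r = (1/2::real)^m" and "h = r / 2^n"
    and "\<phi> = dyadic_steps (Suc n) r" and "\<mu> = line_measure \<phi> h"
  have r: "0 < r" "r < \<epsilon> / 4" and h: "0 < h" using m by (auto simp: r_def h_def)
  have \<phi> [measurable]: "\<phi> \<in> borel_measurable borel" by (simp add: \<phi>_def)
  have \<phi>01: "0 \<le> \<phi> x" "\<phi> x \<le> 1" for x
    using r by (auto simp: \<phi>_def dyadic_steps_nonneg dyadic_steps_le_1)
  have "(\<integral>\<^sup>+ x. ennreal (\<phi> x) \<partial>lborel) \<le> (\<integral>\<^sup>+ x. indicator {-r..r} x \<partial>lborel)"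
    using dyadic_steps_le[OF r(1)]
    by (intro nn_integral_mono) (simp add: \<phi>_def ennreal_indicator[symmetric] ennreal_leI)
  also have "\<dots> = ennreal (2 * r)" using r by simp
  finally have mass: "(\<integral>\<^sup>+ x. ennreal (\<phi> x) \<partial>lborel) \<le> ennreal (2 * r)" .
  have reg: "regular_borel_measure \<mu>"
    unfolding \<mu>_def using le_less_trans[OF mass] by (intro regular_line_measure) auto
  have carl: "emeasure \<mu> (carleson_square I) \<le> ennreal (len I)" if I: "I \<in> bounded_intervals" for I
  proof -
    obtain a b where "a < b" and sub: "I \<subseteq> {a..b}" and l: "len I = b - a" and [measurable]: "I \<in> sets borel"
      using bounded_intervals_enclosure[OF I] .
    have "emeasure \<mu> (carleson_square I) \<le> (\<integral>\<^sup>+ x. indicator {a..b} x \<partial>lborel)"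
      unfolding \<mu>_def using h sub \<phi>01
      by (subst emeasure_line_measure_carleson_square; (intro nn_integral_mono)?) (auto simp: indicator_def)
    then show ?thesis using \<open>a < b\<close> by (simp add: l)
  qed
  have dyadic: "dyadic_intervals \<subseteq> bounded_intervals"
  proof
    fix J assume "J \<in> dyadic_intervals"
    then obtain k p :: int where J: "J = {of_int k * 2 powi p<..(of_int k + 1) * 2 powi p}"
      by (auto simp: dyadic_intervals_def)
    have "(of_int k + 1) * 2 powi p - of_int k * 2 powi p = (2::real) powi p"
      by (simp add: algebra_simps)
    moreover have "(0::real) < 2 powi p" by simp
    ultimately show "J \<in> bounded_intervals"
      unfolding bounded_intervals_def len_def J by (simp add: is_interval_oc)
  qed
  have base: "{0<..h} \<in> dyadic_intervals"
  proof -
    have "h = 2 powi (- int (m + n))"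
      by (simp only: h_def r_def power_int_minus power_int_of_nat)
         (simp add: power_add power_one_over inverse_eq_divide)
    then have "{0<..h} = {of_int 0 * 2 powi (- int (m + n))<..(of_int 0 + 1) * 2 powi (- int (m + n))}"
      by simp
    then show ?thesis unfolding dyadic_intervals_def by blast
  qed
  \<comment> \<open>The square over \<open>{0<..h}\<close> has height exactly \<open>h\<close> and
    includes its top edge, which carries the measure; there \<phi> equals 1 because \<open>h\<close>
    is the innermost radius.\<close>
  have full: "emeasure \<mu> (carleson_square {0<..h}) = ennreal h"
  proof -
    have "emeasure \<mu> (carleson_square {0<..h}) = (\<integral>\<^sup>+ x. indicator {0<..h} x \<partial>lborel)"
      unfolding \<mu>_def using h r dyadic_steps_eq_1[OF r(1), of _ n]
      by (subst emeasure_line_measure_carleson_square; (intro nn_integral_cong)?)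
         (auto simp: indicator_def len_def \<phi>_def h_def)
    then show ?thesis using h by simp
  qed
  have "carleson_measure \<mu>"
    unfolding carleson_measure_def using reg carl by (auto intro!: exI[of _ 1])
  moreover have "Carl \<mu> = 1"
  proof (rule antisym)
    show "Carl \<mu> \<le> 1"
      unfolding Carl_def using carl dyadic by (intro INF_lower2[of 1]) auto
    \<comment> \<open>Any admissible \<open>C\<close> is tested on the single interval
      \<open>{0<..h}\<close>, where the measure of the square equals the length.\<close>
    show "1 \<le> Carl \<mu>"
      unfolding Carl_def
    proof (rule INF_greatest)
      fix C :: real
      assume "C \<in> {C. 0 < C \<and> (\<forall>I\<in>dyadic_intervals. emeasure \<mu> (carleson_square I) \<le> ennreal (C * len I))}"
      then have "0 < C" "emeasure \<mu> (carleson_square {0<..h}) \<le> ennreal (C * len {0<..h})"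
        using base by blast+
      then have "h \<le> C * h" using h by (simp add: full len_def ennreal_le_iff)
      then show "1 \<le> ennreal C" using h by simp
    qed
  qed
  moreover
  note S = real_balayage_line_measure[OF \<phi> h \<phi>01, folded \<mu>_def]
  have S_meas [measurable]: "real_balayage \<mu> \<in> borel_measurable borel"
    unfolding real_balayage_def balayage_line_measure[OF \<phi> h, folded \<mu>_def] by measurable
  have L1: "balayage_L1_norm \<mu> \<le> ennreal (2 * r)"
    using mass by (simp add: \<mu>_def balayage_L1_norm_line_measure[OF \<phi> h])
  have bmo: "BMO_norm (real_balayage \<mu>) \<le> ennreal (2 * (8 / real (Suc n)))"
    using r h convolution_oscillation[OF prob_space_poisson_kernel, of h r "Suc n"]
    by (intro BMO_norm_le) (auto simp: S(1) \<phi>_def)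
  \<comment> \<open>Values in [0, 1] give \<open>S^2 \<le> S\<close> for the balayage
    \<open>S\<close>, so the L1 bound also yields square integrability.\<close>
  have "integrable lborel (\<lambda>t. (real_balayage \<mu> t)\<^sup>2)"
  proof (rule integrableI_nonneg)
    have "(\<integral>\<^sup>+ t. ennreal ((real_balayage \<mu> t)\<^sup>2) \<partial>lborel) \<le> balayage_L1_norm \<mu>"
      unfolding balayage_L1_norm_def S(2) using S(3)
      by (intro nn_integral_mono ennreal_leI) (auto simp: power2_eq_square mult_left_le)
    also have "\<dots> < \<infinity>" using L1 by (auto simp: top_unique less_top[symmetric])
    finally show "(\<integral>\<^sup>+ t. ennreal ((real_balayage \<mu> t)\<^sup>2) \<partial>lborel) < \<infinity>" .
  qed auto
  then have "real_balayage \<mu> \<in> BMO"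
    unfolding BMO_def using bmo by (auto simp: top_unique less_top[symmetric])
  moreover have "BMO_norm (real_balayage \<mu>) + balayage_L1_norm \<mu> < ennreal \<epsilon>"
  proof -
    have "32 < \<epsilon> * real (Suc n)" using n assms by (simp add: field_simps)
    then have "2 * (8 / real (Suc n)) < \<epsilon> / 2"
      by (simp add: field_simps)
    then have sum: "2 * (8 / real (Suc n)) + 2 * r < \<epsilon>"
      using r by linarith
    have "BMO_norm (real_balayage \<mu>) + balayage_L1_norm \<mu> \<le> ennreal (2 * (8 / real (Suc n)) + 2 * r)"
      using add_mono[OF bmo L1] r by (simp add: ennreal_plus)
    also have "\<dots> < ennreal \<epsilon>"
      using sum assms by (intro ennreal_lessI)
    finally show ?thesis .
  qed
  ultimately show ?thesis by blast
qed

end
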